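(* Let $X$ be a Banach space, $(A_n)_{n\in\mathbb Z}$ a sequence in $\mathcal B(X)$, $\mu=(\mu_n)_{n\in\mathbb Z}$ a growth rate and $\nu=(\nu_n)_{n\in\mathbb Z}$ a sequence with $\nu_n\ge1$ for all $n$. Let $(\gamma_n)_{n\in\mathbb Z}$ be a sequence with $\gamma_n>0$ for every $n\in\mathbb Z$ and $\sum_{n\in\mathbb Z}\gamma_n<+\infty$. Suppose that $x_{n+1}=A_nx_n$, $n\in\mathbb Z$, admits a $(\mu,\nu)$-dichotomy with exponent $\lambda>0$, that there exists $\varepsilon\in[0,\lambda)$ with $\sup_{n\in\mathbb N}(\mu_{-n}^{\varepsilon}\nu_{-n})<+\infty$ and $\sup_{n\in\mathbb N}(\mu_n^{-\varepsilon}\nu_n)<+\infty$, and take $\beta\in(0,\lambda-\varepsilon)$. Then there exists $c_0>0$ such that, for every $c\in(0,c_0]$ and every sequence $(B_n)_{n\in\mathbb Z}$ in $\mathcal B(X)$ satisfying \[\|B_n\|\le\frac{c\,\gamma_n\,\mu_n^\beta}{\nu_{n+1}\,\mu_{n+1}^\beta},\quad n\in\mathbb Z,\] the equation $x_{n+1}=(A_n+B_n)x_n$, $n\in\mathbb Z$, also admits a $(\mu,\nu)$-dichotomy.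
   Context: $\mathbb N=\{0,1,2,\dots\}$. $(X,\|\cdot\|)$ is a Banach space and $\mathcal B(X)$ is the space of bounded linear operators on $X$ with the operator norm. A growth rate $\mu=(\mu_n)_{n\in\mathbb Z}$ is a strictly increasing sequence of positive numbers with $\lim_{n\to+\infty}\mu_n=+\infty$ and $\lim_{n\to-\infty}\mu_n=0$. For $m\ge n$, $\mathcal A(m,n)=A_{m-1}\cdots A_n$ if $m>n$ and $\mathcal A(n,n)=\mathrm{Id}$. $(\mu,\nu)$-dichotomy: the equation $x_{n+1}=A_nx_n$, $n\in\mathbb Z$, admits a $(\mu,\nu)$-dichotomy if (1) there are projections $P_n$ on $X$, $n\in\mathbb Z$, with $A_nP_n=P_{n+1}A_n$ for all $n$; (2) $A_n|_{\operatorname{Ker}P_n}:\operatorname{Ker}P_n\to\operatorname{Ker}P_{n+1}$ is invertible for all $n$; (3) there exist $D,\lambda>0$ ($\lambda$ is called the exponent) such that $\|\mathcal A(m,n)P_n\|\le D\nu_n(\mu_m/\mu_n)^{-\lambda}$ for $m\ge n$ and $\|\mathcal A(m,n)(\mathrm{Id}-P_n)\|\le D\nu_n(\mu_n/\mu_m)^{-\lambda}$ for $m\le n$, where for $m\le n$ one sets $\mathcal A(m,n):=(\mathcal A(n,m)|_{\operatorname{Ker}P_m})^{-1}:\operatorname{Ker}P_n\to\operatorname{Ker}P_m$. The projections and the constants $D,\lambda$ for the perturbed equation may differ from those of the original one. *)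

theory Defs
  imports "HOL-Analysis.Analysis"
begin

definition growth_rate :: "(int \<Rightarrow> real) \<Rightarrow> bool" where
  "growth_rate \<mu> \<longleftrightarrow>
     strict_mono \<mu> \<and> (\<forall>n. 0 < \<mu> n) \<and>
     filterlim \<mu> at_top at_top \<and> (\<mu> \<longlongrightarrow> 0) at_bot"

primrec evol_steps ::
  "(int \<Rightarrow> 'a::real_normed_vector \<Rightarrow>\<^sub>L 'a) \<Rightarrow> int \<Rightarrow> nat \<Rightarrow> 'a \<Rightarrow>\<^sub>L 'a" where
  "evol_steps A n 0 = id_blinfun"
| "evol_steps A n (Suc k) = A (n + int k) o\<^sub>L evol_steps A n k"

text \<open>The forward evolution \<open>A (m - 1) \<cdots> A n\<close>; only meaningful for \<open>n \<le> m\<close>.\<close>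

definition evol ::
  "(int \<Rightarrow> 'a::real_normed_vector \<Rightarrow>\<^sub>L 'a) \<Rightarrow> int \<Rightarrow> int \<Rightarrow> 'a \<Rightarrow>\<^sub>L 'a" where
  "evol A m n = evol_steps A n (nat (m - n))"

definition blinfun_ker :: "('a::real_normed_vector \<Rightarrow>\<^sub>L 'a) \<Rightarrow> 'a set" where
  "blinfun_ker P = {x. blinfun_apply P x = 0}"

text \<open>For \<open>m \<le> n\<close>, the inverse of \<open>evol A n m\<close> restricted to a map from the kernel of \<open>P m\<close>
  to the kernel of \<open>P n\<close>; its values outside the kernel of \<open>P n\<close> are irrelevant.\<close>

definition evol_back ::
  "(int \<Rightarrow> 'a::real_normed_vector \<Rightarrow>\<^sub>L 'a) \<Rightarrow> (int \<Rightarrow> 'a \<Rightarrow>\<^sub>L 'a) \<Rightarrow> int \<Rightarrow> int \<Rightarrow> 'a \<Rightarrow> 'a" where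
  "evol_back A P m n = inv_into (blinfun_ker (P m)) (blinfun_apply (evol A n m))"

text \<open>The backward operators are plain functions, so their boundedness is stated next to
  the bound on \<^const>\<open>onorm\<close>, which is meaningful for bounded linear maps only.
  The projections are automatically bounded by the first estimate with \<open>m = n\<close>.\<close>

definition dichotomy_exponent ::
  "(int \<Rightarrow> real) \<Rightarrow> (int \<Rightarrow> real) \<Rightarrow> (int \<Rightarrow> 'a::banach \<Rightarrow>\<^sub>L 'a) \<Rightarrow> real \<Rightarrow> bool" where
  "dichotomy_exponent \<mu> \<nu> A l \<longleftrightarrow> 0 < l \<and>
     (\<exists>P D. 0 < D \<and>
        (\<forall>n. P n o\<^sub>L P n = P n) \<and>
        (\<forall>n. A n o\<^sub>L P n = P (n + 1) o\<^sub>L A n) \<and>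
        (\<forall>n. bij_betw (blinfun_apply (A n)) (blinfun_ker (P n)) (blinfun_ker (P (n + 1)))) \<and>
        (\<forall>m n. n \<le> m \<longrightarrow>
           norm (evol A m n o\<^sub>L P n) \<le> D * \<nu> n * (\<mu> m / \<mu> n) powr (- l)) \<and>
        (\<forall>m n. m \<le> n \<longrightarrow>
           bounded_linear (\<lambda>x. evol_back A P m n (x - blinfun_apply (P n) x)) \<and>
           onorm (\<lambda>x. evol_back A P m n (x - blinfun_apply (P n) x))
             \<le> D * \<nu> n * (\<mu> n / \<mu> m) powr (- l)))"

definition admits_dichotomy ::
  "(int \<Rightarrow> real) \<Rightarrow> (int \<Rightarrow> real) \<Rightarrow> (int \<Rightarrow> 'a::banach \<Rightarrow>\<^sub>L 'a) \<Rightarrow> bool" where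
  "admits_dichotomy \<mu> \<nu> A \<longleftrightarrow> (\<exists>l. dichotomy_exponent \<mu> \<nu> A l)"

end

theory Submission
  imports Defs
begin

text \<open>
  A dichotomy is encoded by its Green function \<open>G m n\<close>, which is \<open>\<A>(m, n) P\<^sub>n\<close> for
  \<open>m \<ge> n\<close> and \<open>- \<A>(m, n) (Id - P\<^sub>n)\<close> for \<open>m < n\<close>. The Green function of the perturbed
  equation is obtained by solving \<open>H m n = G m n + (\<Sum>k. G m (k + 1) B\<^sub>k H k n)\<close>. Since
  \<open>\<beta> \<le> \<lambda>\<close>, the bound on \<open>B\<^sub>k\<close> makes the right-hand side a contraction with respect to the
  weights \<open>exp (- \<beta> \<bar>ln \<mu>\<^sub>m - ln \<mu>\<^sub>n\<bar>)\<close>, with a constant proportional to \<open>c \<Sum>\<gamma>\<^sub>k\<close>, so \<open>H\<close>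
  decays with exponent \<open>\<beta>\<close>. The conditions on \<open>\<epsilon>\<close> give \<open>\<nu>\<^sub>n exp (- \<lambda> \<bar>ln \<mu>\<^sub>n\<bar>) \<rightarrow> 0\<close> at \<open>\<plusminus>\<infinity>\<close>, hence
  bounded two-sided solutions of the unperturbed equation vanish; the contraction carries this
  over to the perturbed equation. Uniqueness of bounded solutions then yields all algebraic
  properties of the projections \<open>H n n\<close>.
\<close>

section \<open>Evolution operators\<close>

interpretation blinfun_compose: bounded_bilinear "(o\<^sub>L)"
  by (rule bounded_bilinear_blinfun_compose)

lemma blinfun_compose_assoc: "(f o\<^sub>L g) o\<^sub>L h = f o\<^sub>L (g o\<^sub>L h)"
  by (rule blinfun_eqI) simp

lemma blinfun_compose_id [simp]: "f o\<^sub>L id_blinfun = f" "id_blinfun o\<^sub>L f = f"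
  by (auto intro: blinfun_eqI)

lemma evol_refl [simp]: "evol A n n = id_blinfun"
  by (simp add: evol_def)

lemma evol_step: "n \<le> m \<Longrightarrow> evol A (m + 1) n = A m o\<^sub>L evol A m n"
proof -
  assume "n \<le> m"
  then have "nat (m + 1 - n) = Suc (nat (m - n))" "n + int (nat (m - n)) = m"
    by linarith+
  then show ?thesis by (simp add: evol_def)
qed

lemma evol_step_right:
  assumes "n < m" shows "evol A m n = evol A m (n + 1) o\<^sub>L A n"
proof -
  from assms have "n + 1 \<le> m" by simp
  then show ?thesis
  proof (induction m rule: int_ge_induct)
    case base
    then show ?case by (simp add: evol_step)
  next
    case (step i)
    then show ?case by (simp add: evol_step blinfun_compose_assoc)
  qed
qed

lemma evol_bij_betw:
  fixes A P :: "int \<Rightarrow> 'a::real_normed_vector \<Rightarrow>\<^sub>L 'a"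
  assumes "\<And>n. bij_betw (A n) (blinfun_ker (P n)) (blinfun_ker (P (n + 1)))" "m \<le> n"
  shows "bij_betw (evol A n m) (blinfun_ker (P m)) (blinfun_ker (P n))"
  using assms(2)
proof (induction n rule: int_ge_induct)
  case base
  have "blinfun_apply (evol A m m) = id" by (auto simp: fun_eq_iff)
  then show ?case by (metis bij_betw_id)
next
  case (step i)
  have "blinfun_apply (evol A (i + 1) m) = A i \<circ> evol A i m"
    using step by (auto simp: evol_step fun_eq_iff)
  then show ?case using bij_betw_trans[OF step.IH assms(1)[of i]] by metis
qed

lemma evol_back_evol:
  fixes A P :: "int \<Rightarrow> 'a::real_normed_vector \<Rightarrow>\<^sub>L 'a"
  assumes "\<And>n. bij_betw (A n) (blinfun_ker (P n)) (blinfun_ker (P (n + 1)))" "m \<le> n"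
    and "u \<in> blinfun_ker (P m)"
  shows "evol_back A P m n (evol A n m u) = u"
  unfolding evol_back_def
  using evol_bij_betw[where A = A and P = P, OF assms(1,2)] assms(3) by (simp add: bij_betw_def)

lemma evol_evol_back:
  fixes A P :: "int \<Rightarrow> 'a::real_normed_vector \<Rightarrow>\<^sub>L 'a"
  assumes "\<And>n. bij_betw (A n) (blinfun_ker (P n)) (blinfun_ker (P (n + 1)))" "m \<le> n"
    and "z \<in> blinfun_ker (P n)"
  shows "evol A n m (evol_back A P m n z) = z" "evol_back A P m n z \<in> blinfun_ker (P m)"
  unfolding evol_back_def
  using evol_bij_betw[where A = A and P = P, OF assms(1,2)] assms(3)
  by (auto simp: bij_betw_def f_inv_into_f inv_into_into)

section \<open>Green functions\<close>

text \<open>Column \<open>n\<close> is a response to a unit impulse arriving at time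
  \<open>n\<close>. The recursion alone does not determine it; decay bounds are stated
  separately.\<close>

definition green_function :: "(int \<Rightarrow> 'a::real_normed_vector \<Rightarrow>\<^sub>L 'a) \<Rightarrow> (int \<Rightarrow> int \<Rightarrow> 'a \<Rightarrow>\<^sub>L 'a) \<Rightarrow> bool"
  where "green_function A G \<longleftrightarrow>
    (\<forall>m n. G (m + 1) n = (A m o\<^sub>L G m n) + (if m + 1 = n then id_blinfun else 0))"

section \<open>Passage between dichotomies and Green functions\<close>

lemma exp_ln_ratio:
  fixes x y :: real
  assumes "0 < x" "0 < y" "y \<le> x"
  shows "(x / y) powr (- a) = exp (- a * \<bar>ln x - ln y\<bar>)"
  using assms by (simp add: powr_def ln_div)

text \<open>On a logarithmic scale both dichotomy estimates become one bound, symmetric in forward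
  and backward time. The recursion in the second argument is recorded as well, since uniqueness of
  bounded solutions will rest on it.\<close>

lemma dichotomy_green_function:
  fixes A :: "int \<Rightarrow> 'a::banach \<Rightarrow>\<^sub>L 'a"
  assumes "dichotomy_exponent \<mu> \<nu> A l" and \<mu>: "\<And>n. 0 < \<mu> n" "strict_mono \<mu>"
  obtains G D where "0 < D" "green_function A G"
    "\<And>m n. G m (n + 1) o\<^sub>L A n = G m n - (if m = n then id_blinfun else 0)"
    "\<And>m n. norm (G m n) \<le> D * \<nu> n * exp (- l * \<bar>ln (\<mu> m) - ln (\<mu> n)\<bar>)"
proof -
  from assms(1) obtain P D where "0 < D"
    and idem: "\<And>n. P n o\<^sub>L P n = P n"
    and inv: "\<And>n. A n o\<^sub>L P n = P (n + 1) o\<^sub>L A n"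
    and bij: "\<And>n. bij_betw (A n) (blinfun_ker (P n)) (blinfun_ker (P (n + 1)))"
    and fw: "\<And>m n. n \<le> m \<Longrightarrow> norm (evol A m n o\<^sub>L P n) \<le> D * \<nu> n * (\<mu> m / \<mu> n) powr (- l)"
    and bl: "\<And>m n. m \<le> n \<Longrightarrow> bounded_linear (\<lambda>x. evol_back A P m n (x - P n x))"
    and bw: "\<And>m n. m \<le> n \<Longrightarrow>
      onorm (\<lambda>x. evol_back A P m n (x - P n x)) \<le> D * \<nu> n * (\<mu> n / \<mu> m) powr (- l)"
    unfolding dichotomy_exponent_def by blast
  \<comment> \<open>With the minus sign, the jump of column \<open>n\<close> at time
    \<open>n\<close> is \<open>P n + (Id - P n) = Id\<close>.\<close>
  define G where "G m n = (if n \<le> m then evol A m n o\<^sub>L P n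
      else - Blinfun (\<lambda>x. evol_back A P m n (x - P n x)))" for m n
  have G_fw: "G m n x = evol A m n (P n x)" if "n \<le> m" for m n x
    using that by (simp add: G_def)
  have G_bw: "G m n x = - evol_back A P m n (x - P n x)" if "m < n" for m n x
    using that bl[of m n] by (simp add: G_def uminus_blinfun.rep_eq bounded_linear_Blinfun_apply)
  have ker: "x - P n x \<in> blinfun_ker (P n)" for n x
    using arg_cong[OF idem[of n], of "\<lambda>f. blinfun_apply f x"]
    by (simp add: blinfun_ker_def blinfun.diff_right)
  have inv': "P (n + 1) (A n x) = A n (P n x)" for n x
    using arg_cong[OF inv[of n], of "\<lambda>f. blinfun_apply f x"] by simp
  have back_refl: "evol_back A P n n z = z" if "z \<in> blinfun_ker (P n)" for n z
    using evol_back_evol[where A=A and P=P and n=n and m=n and u=z] bij that by simp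
  \<comment> \<open>Both sides lie in the kernel of \<open>P (m + 1)\<close> and evolve to
    \<open>z\<close>, where the evolution is injective.\<close>
  have back_step: "A m (evol_back A P m n z) = evol_back A P (m + 1) n z"
    if "m < n" "z \<in> blinfun_ker (P n)" for m n z
  proof -
    let ?u = "evol_back A P m n z"
    have u: "evol A n m ?u = z" "?u \<in> blinfun_ker (P m)"
      using evol_evol_back[where A=A and P=P and n=n and m=m and z=z] bij that by auto
    have "A m ?u \<in> blinfun_ker (P (m + 1))" using bij_betwE[OF bij[of m]] u(2) by blast
    then have "evol_back A P (m + 1) n (evol A n (m + 1) (A m ?u)) = A m ?u"
      using that by (intro evol_back_evol bij) auto
    moreover have "evol A n (m + 1) (A m ?u) = z"
      using u(1) evol_step_right[OF that(1), of A] by simp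
    ultimately show ?thesis by simp
  qed
  have back_step': "evol_back A P m (n + 1) (A n z) = evol_back A P m n z"
    if "m \<le> n" "z \<in> blinfun_ker (P n)" for m n z
  proof -
    let ?u = "evol_back A P m n z"
    have u: "evol A n m ?u = z" "?u \<in> blinfun_ker (P m)"
      using evol_evol_back[where A=A and P=P and n=n and m=m and z=z] bij that by auto
    have "evol_back A P m (n + 1) (evol A (n + 1) m ?u) = ?u"
      using that u by (intro evol_back_evol bij) auto
    then show ?thesis using u(1) that by (simp add: evol_step)
  qed
  have "green_function A G"
    unfolding green_function_def
  proof (intro allI blinfun_eqI)
    fix m n :: int and x :: 'a
    consider "n \<le> m" | "m + 1 = n" | "m + 1 < n" by linarith
    then show "G (m + 1) n x = ((A m o\<^sub>L G m n) + (if m + 1 = n then id_blinfun else 0)) x"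
    proof cases
      case 1 then show ?thesis by (simp add: G_fw evol_step)
    next
      case 2
      then have "A m (evol_back A P m n (x - P n x)) = x - P n x"
        using back_step[of m n] ker back_refl by simp
      with 2 show ?thesis
        by (simp add: G_fw G_bw blinfun.add_left blinfun.minus_right)
    next
      case 3
      then show ?thesis
        by (simp add: G_bw blinfun.minus_right back_step ker)
    qed
  qed
  moreover have "G m (n + 1) o\<^sub>L A n = G m n - (if m = n then id_blinfun else 0)" for m n
  proof (rule blinfun_eqI)
    fix x
    have "evol_back A P m (n + 1) (A n x - P (n + 1) (A n x)) = evol_back A P m n (x - P n x)"
      if "m \<le> n"
      using back_step'[OF that ker[of x n]] by (simp add: inv' blinfun.diff_right)
    moreover have "G m (n + 1) (A n x) = G m n x" if "n < m"
      using that evol_step_right[OF that, of A] by (simp add: G_fw inv')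
    ultimately show "(G m (n + 1) o\<^sub>L A n) x = (G m n - (if m = n then id_blinfun else 0)) x"
      by (cases m n rule: linorder_cases)
        (auto simp: G_bw G_fw blinfun.diff_left back_refl ker)
  qed
  moreover have "norm (G m n) \<le> D * \<nu> n * exp (- l * \<bar>ln (\<mu> m) - ln (\<mu> n)\<bar>)" for m n
  proof (cases "n \<le> m")
    case True
    then have "\<mu> n \<le> \<mu> m" using \<mu>(2) by (simp add: strict_mono_less_eq)
    then show ?thesis
      using fw[OF True] exp_ln_ratio[of "\<mu> m" "\<mu> n" l] \<mu>(1) True by (simp add: G_def)
  next
    case False
    then have "\<mu> m \<le> \<mu> n" using \<mu>(2) by (simp add: strict_mono_less_eq)
    moreover have "norm (G m n) = onorm (\<lambda>x. evol_back A P m n (x - P n x))"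
      using False norm_blinfun.rep_eq[of "Blinfun (\<lambda>x. evol_back A P m n (x - P n x))"] bl[of m n]
      by (simp add: G_def bounded_linear_Blinfun_apply)
    ultimately show ?thesis
      using bw[of m n] exp_ln_ratio[of "\<mu> n" "\<mu> m" l] \<mu>(1) False by (simp add: abs_minus_commute)
  qed
  ultimately show thesis using \<open>0 < D\<close> that by blast
qed

text \<open>By \<open>unique\<close>, every bounded response to an impulse is given by a column of
  \<open>H\<close>. Well-chosen responses yield the projection property, the invariance and the
  inverses on the kernels.\<close>

lemma green_function_dichotomy:
  fixes A :: "int \<Rightarrow> 'a::banach \<Rightarrow>\<^sub>L 'a"
  assumes green: "green_function A H"
    and bound: "\<And>m n. norm (H m n) \<le> K * \<nu> n * exp (- b * \<bar>ln (\<mu> m) - ln (\<mu> n)\<bar>)"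
    and unique: "\<And>y C. (\<And>m. y (m + 1) = A m o\<^sub>L y m) \<Longrightarrow> (\<And>m. norm (y m) \<le> C) \<Longrightarrow> \<forall>m. y m = (0 :: 'a \<Rightarrow>\<^sub>L 'a)"
    and \<mu>: "\<And>n. 0 < \<mu> n" "strict_mono \<mu>"
    and \<nu>: "\<And>n. 1 \<le> \<nu> n" and "0 \<le> K" "0 < b"
  shows "dichotomy_exponent \<mu> \<nu> A b"
proof -
  have H_step: "H (m + 1) n = (A m o\<^sub>L H m n) + (if m + 1 = n then id_blinfun else 0)" for m n
    using green by (simp add: green_function_def)
  have H_bdd: "norm (H m n) \<le> K * \<nu> n" for m n
  proof -
    have "K * \<nu> n * exp (- b * \<bar>ln (\<mu> m) - ln (\<mu> n)\<bar>) \<le> K * \<nu> n * 1"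
      using \<open>0 \<le> K\<close> \<open>0 < b\<close> \<nu>[of n] by (intro mult_left_mono) auto
    then show ?thesis using bound[of m n] by simp
  qed
  \<comment> \<open>The column composed with the amplitude \<open>Y\<close> receives the same
    impulse as \<open>y\<close>, so the difference is a bounded solution of the homogeneous
    equation.\<close>
  have represent: "y m = H m n o\<^sub>L Y"
    if "\<And>m. y (m + 1) = (A m o\<^sub>L y m) + (if m + 1 = n then Y else 0)"
      and "\<And>m. norm (y m) \<le> C" for y and Y :: "'a \<Rightarrow>\<^sub>L 'a" and C m n
  proof -
    have "\<forall>m. y m - (H m n o\<^sub>L Y) = 0"
    proof (rule unique)
      fix m
      show "y (m + 1) - (H (m + 1) n o\<^sub>L Y) = A m o\<^sub>L (y m - (H m n o\<^sub>L Y))"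
        by (simp add: that(1) H_step blinfun_compose.diff_right blinfun_compose.add_left
            blinfun_compose_assoc)
      have "norm (y m - (H m n o\<^sub>L Y)) \<le> norm (y m) + norm (H m n o\<^sub>L Y)"
        by (rule norm_triangle_ineq4)
      also have "\<dots> \<le> C + K * \<nu> n * norm Y"
        by (intro add_mono that(2) order_trans[OF norm_blinfun_compose] mult_right_mono H_bdd) auto
      finally show "norm (y m - (H m n o\<^sub>L Y)) \<le> C + K * \<nu> n * norm Y" .
    qed
    then show ?thesis by simp
  qed
  define P where "P n = H n n" for n
  \<comment> \<open>Each identity below exhibits a second bounded solution of the equation that characterises
    a column of \<open>H\<close>.\<close>
  have idem: "P n o\<^sub>L P n = P n" for n
  proof -
    have "(if n \<le> n then H n n else 0) = H n n o\<^sub>L P n"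
    \<comment> \<open>Column \<open>n\<close>, set to zero before time \<open>n\<close>, starts with
      an impulse of amplitude \<open>P n\<close>.\<close>
    proof (rule represent[where y = "\<lambda>k. if n \<le> k then H k n else 0"
          and C = "K * \<nu> n"])
      fix m
      show "(if n \<le> m + 1 then H (m + 1) n else 0) =
          (A m o\<^sub>L (if n \<le> m then H m n else 0)) + (if m + 1 = n then P n else 0)"
        using H_step[of m n] by (auto simp: P_def)
      show "norm (if n \<le> m then H m n else 0) \<le> K * \<nu> n"
        using H_bdd[of m n] \<open>0 \<le> K\<close> \<nu>[of n] by auto
    qed
    then show ?thesis by (simp add: P_def)
  qed
  have right: "H m (n + 1) o\<^sub>L A n = (if m = n then P n - id_blinfun else H m n)" for m n
  proof -
    have "(if m = n then P n - id_blinfun else H m n) = H m (n + 1) o\<^sub>L A n"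
    \<comment> \<open>Subtracting the identity at the single time \<open>n\<close> removes the
      impulse there and creates the impulse \<open>A n\<close> at \<open>n + 1\<close>.\<close>
    proof (rule represent[where y = "\<lambda>k. if k = n then P n - id_blinfun else H k n"
          and C = "K * \<nu> n + 1"])
      fix m
      show "(if m + 1 = n then P n - id_blinfun else H (m + 1) n) =
          (A m o\<^sub>L (if m = n then P n - id_blinfun else H m n)) + (if m + 1 = n + 1 then A n else 0)"
        using H_step[of m n] by (auto simp: P_def blinfun_compose.diff_right)
      have "norm (H n n - (id_blinfun :: 'a \<Rightarrow>\<^sub>L 'a)) \<le> norm (H n n) + norm (id_blinfun :: 'a \<Rightarrow>\<^sub>L 'a)"
        by (rule norm_triangle_ineq4)
      then show "norm (if m = n then P n - id_blinfun else H m n) \<le> K * \<nu> n + 1"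
        using H_bdd[of m n] H_bdd[of n n] norm_blinfun_id_le[where 'a='a] by (auto simp: P_def)
    qed
    then show ?thesis by simp
  qed
  have inv: "A n o\<^sub>L P n = P (n + 1) o\<^sub>L A n" for n
    using right[of "n + 1" n] H_step[of n n] by (simp add: P_def)
  have P_H: "P m o\<^sub>L H m n = 0" if "m < n" for m n
  proof -
    have "(if m \<le> m then 0 else - H m n) = H m m o\<^sub>L H m n"
    \<comment> \<open>The impulse \<open>H m n\<close> at time \<open>m\<close> cancels the arriving
      negated column; from \<open>m\<close> on the response is zero.\<close>
    proof (rule represent[where y = "\<lambda>k. if m \<le> k then 0 else - H k n"
          and C = "K * \<nu> n"])
      fix k
      show "(if m \<le> k + 1 then 0 else - H (k + 1) n) =
          (A k o\<^sub>L (if m \<le> k then 0 else - H k n)) + (if k + 1 = m then H m n else 0)"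
        using H_step[of k n] that by (auto simp: blinfun_compose.minus_right)
      show "norm (if m \<le> k then 0 else - H k n) \<le> K * \<nu> n"
        using H_bdd[of k n] \<open>0 \<le> K\<close> \<nu>[of n] by auto
    qed
    then show ?thesis by (simp add: P_def)
  qed
  have bij: "bij_betw (A n) (blinfun_ker (P n)) (blinfun_ker (P (n + 1)))" for n
  \<comment> \<open>By \<open>right\<close> and \<open>H_step\<close>, composing
    \<open>H n (n + 1)\<close> with \<open>A n\<close> on either side gives a projection minus the
    identity, which is \<open>-Id\<close> on its kernel.\<close>
  proof (rule bij_betw_byWitness[where f' = "\<lambda>y. - H n (n + 1) y"])
    show "\<forall>x\<in>blinfun_ker (P n). - H n (n + 1) (A n x) = x"
    proof
      fix x assume "x \<in> blinfun_ker (P n)"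
      then show "- H n (n + 1) (A n x) = x"
        using arg_cong[OF right[of n n], of "\<lambda>f. blinfun_apply f x"]
        by (simp add: blinfun_ker_def blinfun.diff_left)
    qed
    show "\<forall>y\<in>blinfun_ker (P (n + 1)). A n (- H n (n + 1) y) = y"
    proof
      fix y assume "y \<in> blinfun_ker (P (n + 1))"
      then have "A n (H n (n + 1) y) + y = 0"
        using arg_cong[OF H_step[of n "n + 1"], of "\<lambda>f. blinfun_apply f y"]
        by (simp add: blinfun_ker_def P_def blinfun.add_left)
      then show "A n (- H n (n + 1) y) = y" by (simp add: blinfun.minus_right minus_unique)
    qed
    show "blinfun_apply (A n) ` blinfun_ker (P n) \<subseteq> blinfun_ker (P (n + 1))"
    proof clarify
      fix x assume "x \<in> blinfun_ker (P n)"
      then show "A n x \<in> blinfun_ker (P (n + 1))"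
        using arg_cong[OF inv[of n], of "\<lambda>f. blinfun_apply f x"] by (simp add: blinfun_ker_def)
    qed
    show "(\<lambda>y. - H n (n + 1) y) ` blinfun_ker (P (n + 1)) \<subseteq> blinfun_ker (P n)"
    proof clarify
      fix y
      show "- H n (n + 1) y \<in> blinfun_ker (P n)"
        using arg_cong[OF P_H[of n "n + 1"], of "\<lambda>f. blinfun_apply f y"]
        by (simp add: blinfun_ker_def blinfun.minus_right)
    qed
  qed
  have evol_H: "evol A m n o\<^sub>L P n = H m n" if "n \<le> m" for m n
    using that
  proof (induction m rule: int_ge_induct)
    case base then show ?case by (simp add: P_def)
  next
    case (step i)
    then show ?case using H_step[of i n] by (simp add: evol_step blinfun_compose_assoc)
  qed
  \<comment> \<open>Candidate for the backward evolution after \<open>Id - P n\<close>. The diagonal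
    is set apart because \<open>H n n\<close> is \<open>P n\<close> there.\<close>
  define U where "U m n = (if m = n then id_blinfun - P n else - H m n)" for m n
  have U_step: "U (m + 1) n = A m o\<^sub>L U m n" if "m < n" for m n
    using that H_step[of m n] by (auto simp: U_def P_def blinfun_compose.minus_right)
  have evol_U: "evol A n m o\<^sub>L U m n = id_blinfun - P n" if "m \<le> n" for m n
    using that
  proof (induction m rule: int_le_induct)
    case base then show ?case by (simp add: U_def)
  next
    case (step i)
    then show ?case
      using evol_step_right[of "i - 1" n A] U_step[of "i - 1" n] by (simp add: blinfun_compose_assoc)
  qed
  \<comment> \<open>\<open>U m n x\<close> lies in the kernel of \<open>P m\<close> and evolves to
    \<open>x - P n x\<close>, which characterises the backward image.\<close>
  have back_U: "evol_back A P m n (x - P n x) = U m n x" if "m \<le> n" for m n x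
  proof -
    have "P m o\<^sub>L U m n = 0"
      using P_H[of m n] idem[of n] that
      by (auto simp: U_def blinfun_compose.diff_right blinfun_compose.minus_right)
    from arg_cong[OF this, of "\<lambda>f. blinfun_apply f x"] have "U m n x \<in> blinfun_ker (P m)"
      by (simp add: blinfun_ker_def)
    then have "evol_back A P m n (evol A n m (U m n x)) = U m n x"
      using that by (intro evol_back_evol bij)
    moreover have "evol A n m (U m n x) = x - P n x"
      using arg_cong[OF evol_U[OF that], of "\<lambda>f. blinfun_apply f x"] by (simp add: blinfun.diff_left)
    ultimately show ?thesis by simp
  qed
  \<comment> \<open>The constant \<open>K + 1\<close> absorbs the identity on the diagonal, whose
    norm is at most \<open>1 \<le> \<nu> n\<close>.\<close>
  have U_bound: "norm (U m n) \<le> (K + 1) * \<nu> n * exp (- b * \<bar>ln (\<mu> m) - ln (\<mu> n)\<bar>)" for m n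
  proof (cases "m = n")
    case True
    have "norm ((id_blinfun :: 'a \<Rightarrow>\<^sub>L 'a) - H n n) \<le> norm (id_blinfun :: 'a \<Rightarrow>\<^sub>L 'a) + norm (H n n)"
      by (rule norm_triangle_ineq4)
    also have "\<dots> \<le> \<nu> n + K * \<nu> n"
      using H_bdd[of n n] norm_blinfun_id_le[where 'a='a] \<nu>[of n] by linarith
    finally show ?thesis using True by (simp add: U_def P_def algebra_simps)
  next
    case False
    have "K * \<nu> n * exp (- b * \<bar>ln (\<mu> m) - ln (\<mu> n)\<bar>) \<le>
        (K + 1) * \<nu> n * exp (- b * \<bar>ln (\<mu> m) - ln (\<mu> n)\<bar>)"
      using \<nu>[of n] by (intro mult_right_mono) auto
    then show ?thesis using False bound[of m n] by (simp add: U_def)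
  qed
  show ?thesis
    unfolding dichotomy_exponent_def
  proof (intro conjI exI[of _ P] exI[of _ "K + 1"] allI impI idem inv bij)
    show "0 < b" "0 < K + 1" using assms by auto
    fix m n :: int
    {
      assume "n \<le> m"
      then have "\<mu> n \<le> \<mu> m" using \<mu>(2) by (simp add: strict_mono_less_eq)
      then have eq: "(\<mu> m / \<mu> n) powr (- b) = exp (- b * \<bar>ln (\<mu> m) - ln (\<mu> n)\<bar>)"
        using exp_ln_ratio \<mu>(1) by blast
      have "norm (evol A m n o\<^sub>L P n) \<le> K * \<nu> n * exp (- b * \<bar>ln (\<mu> m) - ln (\<mu> n)\<bar>)"
        using bound evol_H[OF \<open>n \<le> m\<close>] by simp
      also have "\<dots> \<le> (K + 1) * \<nu> n * exp (- b * \<bar>ln (\<mu> m) - ln (\<mu> n)\<bar>)"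
        using \<nu>[of n] by (intro mult_right_mono) auto
      finally show "norm (evol A m n o\<^sub>L P n) \<le> (K + 1) * \<nu> n * (\<mu> m / \<mu> n) powr (- b)"
        by (simp only: eq)
    next
      assume "m \<le> n"
      then have "\<mu> m \<le> \<mu> n" using \<mu>(2) by (simp add: strict_mono_less_eq)
      then have eq: "(\<mu> n / \<mu> m) powr (- b) = exp (- b * \<bar>ln (\<mu> m) - ln (\<mu> n)\<bar>)"
        using exp_ln_ratio[of "\<mu> n" "\<mu> m" b] \<mu>(1) by (simp add: abs_minus_commute)
      have U_eq: "(\<lambda>x. evol_back A P m n (x - P n x)) = blinfun_apply (U m n)"
        using back_U[OF \<open>m \<le> n\<close>] by blast
      show "bounded_linear (\<lambda>x. evol_back A P m n (x - P n x))"
        unfolding U_eq by (rule blinfun.bounded_linear_right)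
      show "onorm (\<lambda>x. evol_back A P m n (x - P n x)) \<le> (K + 1) * \<nu> n * (\<mu> n / \<mu> m) powr (- b)"
        unfolding U_eq eq using U_bound[of m n] by (simp add: norm_blinfun.rep_eq)
    }
  qed
qed

section \<open>Perturbation of a Green function\<close>

lemma halving_bound_imp_nonpos:
  fixes x C :: real
  assumes "\<And>j. x \<le> C * (1 / 2) ^ j"
  shows "x \<le> 0"
proof -
  have "(\<lambda>j. C * (1 / 2) ^ j) \<longlonglongrightarrow> C * 0"
    by (intro tendsto_intros LIMSEQ_realpow_zero) auto
  then have "x \<le> C * 0"
    by (rule LIMSEQ_le_const) (use assms in blast)
  then show ?thesis by simp
qed

text \<open>\<open>\<tau>\<close> stands for \<open>ln \<mu>\<close>. \<open>G_decay\<close> carries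
  what the growth conditions on \<open>\<nu>\<close> contribute, and \<open>small\<close> gives
  \<open>T\<close> below the contraction factor 1/2.\<close>

locale green_perturbation =
  fixes A B :: "int \<Rightarrow> 'a::banach \<Rightarrow>\<^sub>L 'a" and G :: "int \<Rightarrow> int \<Rightarrow> 'a \<Rightarrow>\<^sub>L 'a"
    and \<tau> \<nu> \<gamma> :: "int \<Rightarrow> real" and D l b c :: real
  assumes \<tau>_mono: "mono \<tau>"
    and green: "green_function A G"
    and G_right: "\<And>m n. G m (n + 1) o\<^sub>L A n = G m n - (if m = n then id_blinfun else 0)"
    and G_bound: "\<And>m n. norm (G m n) \<le> D * \<nu> n * exp (- l * \<bar>\<tau> m - \<tau> n\<bar>)"
    and G_decay: "\<And>m. ((\<lambda>n. \<nu> n * exp (- l * \<bar>\<tau> m - \<tau> n\<bar>)) \<longlongrightarrow> 0) at_top"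
      "\<And>m. ((\<lambda>n. \<nu> n * exp (- l * \<bar>\<tau> m - \<tau> n\<bar>)) \<longlongrightarrow> 0) at_bot"
    and B_bound: "\<And>k. \<nu> (k + 1) * norm (B k) \<le> c * \<gamma> k * exp (- b * (\<tau> (k + 1) - \<tau> k))"
    and \<gamma>_nonneg: "\<And>k. 0 \<le> \<gamma> k" and \<gamma>_summable: "\<gamma> summable_on UNIV"
    and const: "0 \<le> D" "0 \<le> c" "0 \<le> b" "b \<le> l"
    and small: "D * c * infsum \<gamma> UNIV \<le> 1 / 2"
begin

text \<open>One notion covers the constant weight, for uniqueness, and the exponential weights
  centred at \<open>n\<close>, for the decay of column \<open>n\<close>.\<close>

definition weight :: "(int \<Rightarrow> real) \<Rightarrow> bool"
  where "weight v \<longleftrightarrow> (\<forall>k. 0 \<le> v k) \<and> (\<forall>k m. v k \<le> v m * exp (b * \<bar>\<tau> k - \<tau> m\<bar>))"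

text \<open>The response of the unperturbed equation to the forcing
  \<open>B k o\<^sub>L y k\<close>, which arrives at time \<open>k + 1\<close>.\<close>

definition T :: "(int \<Rightarrow> 'a \<Rightarrow>\<^sub>L 'a) \<Rightarrow> int \<Rightarrow> 'a \<Rightarrow>\<^sub>L 'a"
  where "T y m = (\<Sum>\<^sub>\<infinity>k. G m (k + 1) o\<^sub>L (B k o\<^sub>L y k))"

section \<open>Estimates for \<open>T\<close> in weighted norms\<close>

lemma weight_one: "weight (\<lambda>_. 1)"
  using const by (simp add: weight_def)

lemma weight_exp: "weight (\<lambda>m. exp (- b * \<bar>\<tau> m - \<tau> n\<bar>))"
  unfolding weight_def
proof (intro conjI allI)
  fix k m
  have "b * \<bar>\<tau> m - \<tau> n\<bar> \<le> b * (\<bar>\<tau> k - \<tau> n\<bar> + \<bar>\<tau> k - \<tau> m\<bar>)"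
    using const by (intro mult_left_mono) auto
  then show "exp (- b * \<bar>\<tau> k - \<tau> n\<bar>) \<le> exp (- b * \<bar>\<tau> m - \<tau> n\<bar>) * exp (b * \<bar>\<tau> k - \<tau> m\<bar>)"
    unfolding exp_add [symmetric] by (simp add: algebra_simps)
qed auto

text \<open>Comparing \<open>v k\<close> with \<open>v m\<close> costs a factor governed by the
  distance from \<open>\<tau> k\<close> to \<open>\<tau> m\<close>. The decay of \<open>G\<close>
  pays for the part from \<open>m\<close> to \<open>k + 1\<close>, as \<open>b \<le> l\<close>, and
  the bound on \<open>B k\<close> pays for the step from \<open>k\<close> to \<open>k + 1\<close>
  and for \<open>\<nu> (k + 1)\<close>.\<close>

lemma T_term_bound:
  assumes v: "weight v" and y: "\<And>k. norm (y k) \<le> C * v k" and "0 \<le> C"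
  shows "norm (G m (k + 1) o\<^sub>L (B k o\<^sub>L y k)) \<le> D * c * C * v m * \<gamma> k"
proof -
  define E1 E2 E3 where "E1 = exp (- l * \<bar>\<tau> m - \<tau> (k + 1)\<bar>)"
    and "E2 = exp (- b * (\<tau> (k + 1) - \<tau> k))" and "E3 = exp (b * \<bar>\<tau> k - \<tau> m\<bar>)"
  have vm: "0 \<le> v m" "v k \<le> v m * E3" using v by (auto simp: weight_def E3_def)
  have "\<tau> k \<le> \<tau> (k + 1)" using \<tau>_mono by (simp add: monoD)
  then have "b * \<bar>\<tau> k - \<tau> m\<bar> \<le> b * (\<bar>\<tau> m - \<tau> (k + 1)\<bar> + (\<tau> (k + 1) - \<tau> k))"
    using const by (intro mult_left_mono) auto
  moreover have "b * \<bar>\<tau> m - \<tau> (k + 1)\<bar> \<le> l * \<bar>\<tau> m - \<tau> (k + 1)\<bar>"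
    using const by (intro mult_right_mono) auto
  ultimately have E: "E1 * E2 * E3 \<le> 1"
    unfolding E1_def E2_def E3_def exp_add [symmetric] by (simp add: algebra_simps)
  have "norm (G m (k + 1) o\<^sub>L (B k o\<^sub>L y k)) \<le> norm (G m (k + 1)) * (norm (B k) * norm (y k))"
    by (intro order_trans[OF norm_blinfun_compose] mult_left_mono norm_blinfun_compose) auto
  also have "\<dots> \<le> (D * \<nu> (k + 1) * E1) * (norm (B k) * (C * (v m * E3)))"
  proof (intro mult_mono G_bound[of m "k + 1", folded E1_def] order_refl)
    show "norm (y k) \<le> C * (v m * E3)"
      using y[of k] mult_left_mono[OF vm(2) \<open>0 \<le> C\<close>] by linarith
    \<comment> \<open>The sign is read off from the norm that this product bounds.\<close>
    show "0 \<le> D * \<nu> (k + 1) * E1"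
      using G_bound[of m "k + 1", folded E1_def] norm_ge_zero order_trans by blast
  qed auto
  also have "\<dots> = (D * E1 * (C * (v m * E3))) * (\<nu> (k + 1) * norm (B k))"
    by (simp add: algebra_simps)
  also have "\<dots> \<le> (D * E1 * (C * (v m * E3))) * (c * \<gamma> k * E2)"
    using const \<open>0 \<le> C\<close> vm B_bound[of k]
    by (intro mult_left_mono) (auto simp: E1_def E2_def E3_def)
  also have "\<dots> = (D * c * C * v m * \<gamma> k) * (E1 * E2 * E3)"
    by (simp add: algebra_simps)
  also have "\<dots> \<le> (D * c * C * v m * \<gamma> k) * 1"
    using const \<open>0 \<le> C\<close> vm \<gamma>_nonneg[of k] by (intro mult_left_mono E) auto
  finally show ?thesis by simp
qed

lemma T_summable:
  assumes "weight v" "\<And>k. norm (y k) \<le> C * v k" "0 \<le> C"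
  shows "(\<lambda>k. G m (k + 1) o\<^sub>L (B k o\<^sub>L y k)) summable_on UNIV"
proof (rule abs_summable_summable, rule Infinite_Sum.abs_summable_on_comparison_test')
  show "(\<lambda>k. D * c * C * v m * \<gamma> k) summable_on UNIV"
    using \<gamma>_summable by (rule summable_on_cmult_right)
qed (rule T_term_bound[OF assms])

lemma T_bound:
  assumes "weight v" "\<And>k. norm (y k) \<le> C * v k" "0 \<le> C"
  shows "norm (T y m) \<le> C / 2 * v m"
proof -
  have "norm (T y m) \<le> D * c * C * v m * infsum \<gamma> UNIV"
    unfolding T_def
  proof (rule norm_infsum_le)
    show "((\<lambda>k. D * c * C * v m * \<gamma> k) has_sum D * c * C * v m * infsum \<gamma> UNIV) UNIV"
      using \<gamma>_summable by (intro has_sum_cmult_right has_sum_infsum)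
  qed (use T_summable[OF assms] T_term_bound[OF assms] in auto)
  also have "\<dots> = (D * c * infsum \<gamma> UNIV) * (C * v m)"
    by (simp add: algebra_simps)
  also have "\<dots> \<le> 1 / 2 * (C * v m)"
    using small assms by (intro mult_right_mono) (auto simp: weight_def)
  finally show ?thesis by simp
qed

text \<open>Splitting the infinite sum requires both parts to be summable, which the weighted bounds
  ensure.\<close>

lemma T_diff:
  assumes "weight v" "\<And>k. norm (y k) \<le> C * v k" "0 \<le> C" "\<And>k. norm (z k) \<le> C' * v k" "0 \<le> C'"
  shows "T (\<lambda>k. y k - z k) m = T y m - T z m"
proof -
  have "((\<lambda>k. (G m (k + 1) o\<^sub>L (B k o\<^sub>L y k)) + - (G m (k + 1) o\<^sub>L (B k o\<^sub>L z k)))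
      has_sum T y m + - T z m) UNIV"
    unfolding T_def
    using T_summable[OF assms(1-3)] T_summable[OF assms(1,4,5)]
    by (intro has_sum_add has_sum_uminus[THEN iffD2] has_sum_infsum) auto
  then show ?thesis
    unfolding T_def by (intro infsumI) (simp add: blinfun_compose.diff_right T_def)
qed

lemma T_step:
  assumes "weight v" "\<And>k. norm (y k) \<le> C * v k" "0 \<le> C"
  shows "T y (m + 1) = (A m o\<^sub>L T y m) + (B m o\<^sub>L y m)"
proof -
  let ?f = "\<lambda>k. G m (k + 1) o\<^sub>L (B k o\<^sub>L y k)"
  have "(?f has_sum T y m) UNIV"
    unfolding T_def using T_summable[OF assms] by (rule has_sum_infsum)
  then have 1: "((\<lambda>k. A m o\<^sub>L ?f k) has_sum (A m o\<^sub>L T y m)) UNIV"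
    by (rule has_sum_bounded_linear[OF blinfun_compose.bounded_linear_right])
  \<comment> \<open>Passing from time \<open>m\<close> to \<open>m + 1\<close>, only the column with
    \<open>k = m\<close> receives its impulse.\<close>
  have 2: "((\<lambda>k. if k = m then B m o\<^sub>L y m else 0) has_sum (B m o\<^sub>L y m)) UNIV"
    by (subst has_sum_cong_neutral[where T = "{m}" and g = "\<lambda>_. B m o\<^sub>L y m"])
      (auto intro: has_sum_finiteI)
  have "(A m o\<^sub>L ?f k) + (if k = m then B m o\<^sub>L y m else 0) = G (m + 1) (k + 1) o\<^sub>L (B k o\<^sub>L y k)" for k
    using green by (simp add: green_function_def blinfun_compose.add_left blinfun_compose_assoc)
  with has_sum_add[OF 1 2] show ?thesis
    unfolding T_def by (intro infsumI) simp
qed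

section \<open>Bounded solutions: uniqueness and existence\<close>

text \<open>For a solution \<open>y\<close>, the product \<open>G m n y\<^sub>n\<close> does not depend on \<open>n \<le> m\<close>, nor on \<open>n > m\<close>,
  and it tends to \<open>0\<close> in both directions; its jump between \<open>n = m\<close> and \<open>n = m + 1\<close> is \<open>y\<^sub>m\<close>.\<close>

lemma unperturbed_unique:
  fixes y :: "int \<Rightarrow> 'a \<Rightarrow>\<^sub>L 'a"
  assumes y: "\<And>m. y (m + 1) = A m o\<^sub>L y m" and C: "\<And>m. norm (y m) \<le> C"
  shows "y m = 0"
proof -
  have shift: "G m (n + 1) o\<^sub>L y (n + 1) = (G m n o\<^sub>L y n) - (if m = n then y n else 0)" for n
    using G_right[of m n]
    by (auto simp: y blinfun_compose_assoc [symmetric] blinfun_compose.diff_left)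
  \<comment> \<open>A general filter \<open>F\<close> lets one argument serve both ends of the
    integers.\<close>
  have vanish: "Z = 0"
    if ev: "eventually (\<lambda>n. G m n o\<^sub>L y n = Z) F" and F: "F \<noteq> bot"
      and lim: "((\<lambda>n. \<nu> n * exp (- l * \<bar>\<tau> m - \<tau> n\<bar>)) \<longlongrightarrow> 0) F" for Z F
  proof -
    have *: "norm (G m n o\<^sub>L y n) \<le> D * C * (\<nu> n * exp (- l * \<bar>\<tau> m - \<tau> n\<bar>))" for n
    proof -
      have "norm (G m n o\<^sub>L y n) \<le> norm (G m n) * norm (y n)" by (rule norm_blinfun_compose)
      also have "\<dots> \<le> (D * \<nu> n * exp (- l * \<bar>\<tau> m - \<tau> n\<bar>)) * C"
        by (intro mult_mono G_bound C order_trans[OF norm_ge_zero G_bound] norm_ge_zero)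
      finally show ?thesis by (simp add: algebra_simps)
    qed
    have "eventually (\<lambda>n. norm Z \<le> D * C * (\<nu> n * exp (- l * \<bar>\<tau> m - \<tau> n\<bar>))) F"
      using ev by (rule eventually_mono) (use * in metis)
    moreover have "((\<lambda>n. D * C * (\<nu> n * exp (- l * \<bar>\<tau> m - \<tau> n\<bar>))) \<longlongrightarrow> 0) F"
      using tendsto_mult_right_zero[OF lim] by simp
    ultimately have "norm Z \<le> 0" using F tendsto_lowerbound by blast
    then show ?thesis by simp
  qed
  have "G m n o\<^sub>L y n = G m m o\<^sub>L y m" if "n \<le> m" for n
    using that
  proof (induction n rule: int_le_induct)
    case (step i)
    then show ?case using shift[of "i - 1"] by simp
  qed simp
  then have "eventually (\<lambda>n. G m n o\<^sub>L y n = G m m o\<^sub>L y m) at_bot"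
    unfolding eventually_at_bot_linorder by blast
  then have "G m m o\<^sub>L y m = 0"
    by (rule vanish[OF _ _ G_decay(2)]) simp
  moreover have "G m n o\<^sub>L y n = G m (m + 1) o\<^sub>L y (m + 1)" if "m + 1 \<le> n" for n
    using that
  proof (induction n rule: int_ge_induct)
    case (step i)
    then show ?case using shift[of i] by simp
  qed simp
  then have "eventually (\<lambda>n. G m n o\<^sub>L y n = G m (m + 1) o\<^sub>L y (m + 1)) at_top"
    unfolding eventually_at_top_linorder by blast
  then have "G m (m + 1) o\<^sub>L y (m + 1) = 0"
    by (rule vanish[OF _ _ G_decay(1)]) simp
  ultimately show ?thesis using shift[of m] by simp
qed

text \<open>\<open>T\<close> absorbs the perturbation: \<open>y - T y\<close> is a bounded
  unperturbed solution, hence zero. The fixed point \<open>y = T y\<close> then halves its own bound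
  indefinitely.\<close>

lemma perturbed_unique:
  fixes y :: "int \<Rightarrow> 'a \<Rightarrow>\<^sub>L 'a"
  assumes y: "\<And>m. y (m + 1) = (A m + B m) o\<^sub>L y m" and C: "\<And>m. norm (y m) \<le> C"
  shows "y m = 0"
proof -
  have "0 \<le> C" using C[of 0] norm_ge_zero order_trans by blast
  have T_fix: "T y m = y m" for m
  proof -
    have "y m - T y m = 0"
    proof (rule unperturbed_unique)
      fix m
      show "y (m + 1) - T y (m + 1) = A m o\<^sub>L (y m - T y m)"
        using T_step[OF weight_one, of y C m] C \<open>0 \<le> C\<close>
        by (simp add: y blinfun_compose.add_left blinfun_compose.diff_right)
      have "norm (T y m) \<le> C / 2"
        using T_bound[OF weight_one, of y C m] C \<open>0 \<le> C\<close> by simp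
      then show "norm (y m - T y m) \<le> C + C / 2"
        using norm_triangle_ineq4[of "y m" "T y m"] C[of m] by linarith
    qed
    then show ?thesis by simp
  qed
  have "norm (y m) \<le> C * (1 / 2) ^ j" for j m
  proof (induction j arbitrary: m)
    case 0
    then show ?case using C by simp
  next
    case (Suc j)
    then show ?case
      using T_bound[OF weight_one, of y "C * (1 / 2) ^ j" m] \<open>0 \<le> C\<close> by (simp add: T_fix)
  qed
  then have "norm (y m) \<le> 0" by (rule halving_bound_imp_nonpos)
  then show ?thesis by simp
qed

text \<open>The solution is the Neumann series of the iterates of \<open>T\<close> on
  \<open>g\<close>. Their weighted bounds halve at each step, and the geometric sum produces the
  factor 2.\<close>

lemma weighted_fixed_point:
  assumes v: "weight v" "\<And>k. 0 < v k" and g: "\<And>m. norm (g m) \<le> K * v m"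
  shows "\<exists>h. (\<forall>m. h m = g m + T h m) \<and> (\<forall>m. norm (h m) \<le> 2 * K * v m)"
proof -
  have "0 \<le> K" using g[of 0] v(2)[of 0] norm_ge_zero[of "g 0"]
    by (meson order_trans not_less zero_le_mult_iff)
  define z where "z j = (T ^^ j) g" for j
  define s where "s N m = (\<Sum>j<N. z j m)" for N m
  define h where "h m = (\<Sum>j. z j m)" for m
  have z_bound: "norm (z j m) \<le> K * (1 / 2) ^ j * v m" for j m
  proof (induction j arbitrary: m)
    case (Suc j)
    then show ?case
      using T_bound[OF v(1), of "z j" "K * (1 / 2) ^ j" m] \<open>0 \<le> K\<close> by (simp add: z_def)
  qed (use g in \<open>simp add: z_def\<close>)
  have z_summable: "summable (\<lambda>j. z j m)" for m
    by (rule summable_comparison_test'[where g = "\<lambda>j. K * (1 / 2) ^ j * v m"])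
      (auto intro: summable_mult summable_mult2 summable_geometric z_bound)
  have tail: "norm (h m - s N m) \<le> 2 * K * (1 / 2) ^ N * v m" for m N
  proof -
    have sums: "(\<lambda>j. K * (1 / 2) ^ (j + N) * v m) sums (2 * K * (1 / 2) ^ N * v m)"
      using sums_mult[OF geometric_sums[of "1 / 2 :: real"], of "K * (1 / 2) ^ N * v m"]
      by (simp add: power_add mult_ac)
    have "h m - s N m = (\<Sum>j. z (j + N) m)"
      unfolding h_def s_def by (rule suminf_minus_initial_segment [symmetric]) (rule z_summable)
    also have "norm \<dots> \<le> (\<Sum>j. K * (1 / 2) ^ (j + N) * v m)"
      by (rule norm_suminf_le[OF z_bound sums_summable[OF sums]])
    finally show ?thesis using sums_unique[OF sums] by simp
  qed
  \<comment> \<open>This bound grows with \<open>N\<close>; it serves to put each partial sum within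
    reach of \<open>T_diff\<close>.\<close>
  have s_bound: "norm (s N m) \<le> real N * K * v m" for N m
  proof -
    have "norm (z j m) \<le> K * v m" for j
    proof -
      have "K * (1 / 2) ^ j * v m \<le> K * 1 * v m"
        using \<open>0 \<le> K\<close> v(2)[of m] by (intro mult_left_mono mult_right_mono power_le_one) auto
      then show ?thesis using z_bound[of j m] by simp
    qed
    then show ?thesis
      using sum_norm_bound[of "{..<N}" "\<lambda>j. z j m" "K * v m"] by (simp add: s_def mult.assoc)
  qed
  have T_s: "T (s N) m = s (Suc N) m - g m" for N m
  proof (induction N)
    case 0
    show ?case by (simp add: s_def T_def z_def)
  next
    case (Suc N)
    have "T (\<lambda>k. s (Suc N) k - z N k) m = T (s (Suc N)) m - T (z N) m"
      using \<open>0 \<le> K\<close> by (intro T_diff[OF v(1) s_bound _ z_bound]) auto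
    moreover have "(\<lambda>k. s (Suc N) k - z N k) = s N" "T (z N) = z (Suc N)"
      by (auto simp: s_def z_def)
    ultimately have "T (s (Suc N)) m = T (s N) m + z (Suc N) m" by simp
    moreover have "s (Suc (Suc N)) m = s (Suc N) m + z (Suc N) m" by (simp add: s_def)
    ultimately show ?case using Suc by simp
  qed
  have "h m = g m + T h m" for m
  proof -
    \<comment> \<open>Since \<open>s (Suc N) = g + T (s N)\<close>, the defect is a tail of the
      series minus \<open>T\<close> of the preceding tail.\<close>
    have "norm (h m - (g m + T h m)) \<le> 2 * K * v m * (1 / 2) ^ N" for N
    proof -
      have h_bound: "norm (h k) \<le> 2 * K * v k" for k
        using tail[of k 0] by (simp add: s_def)
      have "T (\<lambda>k. h k - s N k) m = T h m - T (s N) m"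
        using \<open>0 \<le> K\<close> by (intro T_diff[OF v(1) h_bound _ s_bound]) auto
      moreover have "norm (T (\<lambda>k. h k - s N k) m) \<le> 2 * K * (1 / 2) ^ N / 2 * v m"
        using \<open>0 \<le> K\<close> by (intro T_bound[OF v(1) tail]) auto
      ultimately have 1: "norm (T h m - T (s N) m) \<le> K * v m * (1 / 2) ^ N"
        by (simp add: mult_ac)
      have 2: "norm (h m - s (Suc N) m) \<le> K * v m * (1 / 2) ^ N"
        using tail[of m "Suc N"] by (simp add: mult_ac)
      have 3: "h m - (g m + T h m) = (h m - s (Suc N) m) - (T h m - T (s N) m)"
        by (simp add: T_s)
      have "norm (h m - (g m + T h m)) \<le> K * v m * (1 / 2) ^ N + K * v m * (1 / 2) ^ N"
        unfolding 3 by (rule order_trans[OF norm_triangle_ineq4 add_mono[OF 2 1]])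
      then show ?thesis by linarith
    qed
    then have "norm (h m - (g m + T h m)) \<le> 0" by (rule halving_bound_imp_nonpos)
    then show ?thesis by simp
  qed
  moreover have "norm (h m) \<le> 2 * K * v m" for m
    using tail[of m 0] by (simp add: s_def)
  ultimately show ?thesis by blast
qed

text \<open>The fixed-point equation is solved column by column, with the weight centred at
  \<open>n\<close>. \<open>T_step\<close> supplies the term with \<open>B\<close>, while
  \<open>G\<close> supplies the unit impulse.\<close>

lemma perturbed_green_function:
  assumes \<nu>: "\<And>n. 0 \<le> \<nu> n"
  obtains H where "green_function (\<lambda>n. A n + B n) H"
    "\<And>m n. norm (H m n) \<le> 2 * D * \<nu> n * exp (- b * \<bar>\<tau> m - \<tau> n\<bar>)"
proof -
  have "\<exists>h. (\<forall>m. h m = G m n + T h m) \<and>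
      (\<forall>m. norm (h m) \<le> 2 * (D * \<nu> n) * exp (- b * \<bar>\<tau> m - \<tau> n\<bar>))" for n
  proof (rule weighted_fixed_point[OF weight_exp])
    fix m
    have "b * \<bar>\<tau> m - \<tau> n\<bar> \<le> l * \<bar>\<tau> m - \<tau> n\<bar>"
      using const by (intro mult_right_mono) auto
    then have "D * \<nu> n * exp (- l * \<bar>\<tau> m - \<tau> n\<bar>) \<le> D * \<nu> n * exp (- b * \<bar>\<tau> m - \<tau> n\<bar>)"
      using const \<nu>[of n] by (intro mult_left_mono) auto
    then show "norm (G m n) \<le> D * \<nu> n * exp (- b * \<bar>\<tau> m - \<tau> n\<bar>)"
      using G_bound[of m n] by linarith
  qed auto
  \<comment> \<open>Here \<open>h n\<close> is a whole column, so its arguments are swapped relative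
    to \<open>H\<close>.\<close>
  then obtain h where h: "\<And>n m. h n m = G m n + T (h n) m"
    and bound: "\<And>n m. norm (h n m) \<le> 2 * (D * \<nu> n) * exp (- b * \<bar>\<tau> m - \<tau> n\<bar>)"
    by metis
  have "green_function (\<lambda>n. A n + B n) (\<lambda>m n. h n m)"
    unfolding green_function_def
  proof (intro allI)
    fix m n
    have "T (h n) (m + 1) = (A m o\<^sub>L T (h n) m) + (B m o\<^sub>L h n m)"
      using const \<nu>[of n] by (intro T_step[OF weight_exp bound]) auto
    then have "h n (m + 1) = (A m o\<^sub>L (G m n + T (h n) m)) + (B m o\<^sub>L h n m)
        + (if m + 1 = n then id_blinfun else 0)"
      using green by (simp add: h[of n "m + 1"] green_function_def blinfun_compose.add_right)
    then show "h n (m + 1) = ((A m + B m) o\<^sub>L h n m) + (if m + 1 = n then id_blinfun else 0)"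
      by (simp add: h[of n m, symmetric] blinfun_compose.add_left)
  qed
  with bound that show thesis by (simp add: mult.assoc)
qed

end

section \<open>Decay of the weights and proof of the theorem\<close>

lemma exp_weight_decay:
  fixes \<tau> \<nu> :: "int \<Rightarrow> real"
  assumes "filterlim \<tau> at_top F" "eventually (\<lambda>n. \<nu> n \<le> M * exp (e * \<tau> n)) F"
    and "\<And>n. 0 \<le> \<nu> n" "e < l" "0 \<le> l"
  shows "((\<lambda>n. \<nu> n * exp (- l * \<bar>t - \<tau> n\<bar>)) \<longlongrightarrow> 0) F"
proof (rule tendsto_sandwich[where f = "\<lambda>_. 0"])
  have "filterlim (\<lambda>n. (l - e) * \<tau> n) at_top F"
    using assms by (intro filterlim_tendsto_pos_mult_at_top[OF tendsto_const]) auto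
  then have "filterlim (\<lambda>n. - ((l - e) * \<tau> n)) at_bot F"
    by (simp add: filterlim_uminus_at_bot)
  then have "((\<lambda>n. exp (- ((l - e) * \<tau> n))) \<longlongrightarrow> 0) F"
    using filterlim_compose exp_at_bot by blast
  then show "((\<lambda>n. (M * exp (l * t)) * exp (- ((l - e) * \<tau> n))) \<longlongrightarrow> 0) F"
    by (rule tendsto_mult_right_zero)
  show "\<forall>\<^sub>F n in F. \<nu> n * exp (- l * \<bar>t - \<tau> n\<bar>) \<le> (M * exp (l * t)) * exp (- ((l - e) * \<tau> n))"
    using assms(2)
  proof (rule eventually_mono)
    fix n
    assume n: "\<nu> n \<le> M * exp (e * \<tau> n)"
    \<comment> \<open>Dropping the absolute value leaves the constant \<open>exp (l * t)\<close> and
      the rate \<open>l\<close>, which beats the growth rate \<open>e\<close> of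
      \<open>\<nu>\<close>.\<close>
    have "l * (\<tau> n - t) \<le> l * \<bar>t - \<tau> n\<bar>"
      using assms by (intro mult_left_mono) auto
    then have "- l * \<bar>t - \<tau> n\<bar> \<le> l * (t - \<tau> n)"
      by (simp add: algebra_simps)
    then have "\<nu> n * exp (- l * \<bar>t - \<tau> n\<bar>) \<le> (M * exp (e * \<tau> n)) * exp (l * (t - \<tau> n))"
      using n assms(3)[of n] by (intro mult_mono) auto
    also have "\<dots> = (M * exp (l * t)) * exp (- ((l - e) * \<tau> n))"
      by (simp add: exp_add [symmetric] algebra_simps)
    finally show "\<nu> n * exp (- l * \<bar>t - \<tau> n\<bar>) \<le> \<dots>" .
  qed
qed (use assms in auto)

theorem theorem4p11:
  fixes A :: "int \<Rightarrow> 'a::banach \<Rightarrow>\<^sub>L 'a"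
    and \<mu> \<nu> \<gamma> :: "int \<Rightarrow> real"
    and l \<epsilon> \<beta> :: real
  assumes "growth_rate \<mu>"
    and "\<And>n. 1 \<le> \<nu> n"
    and "\<And>n. 0 < \<gamma> n"
    and "\<gamma> summable_on UNIV"
    and "0 < l"
    and "dichotomy_exponent \<mu> \<nu> A l"
    and "0 \<le> \<epsilon>" and "\<epsilon> < l"
    and "bdd_above (range (\<lambda>n::nat. \<mu> (- int n) powr \<epsilon> * \<nu> (- int n)))"
    and "bdd_above (range (\<lambda>n::nat. \<mu> (int n) powr (- \<epsilon>) * \<nu> (int n)))"
    and "0 < \<beta>" and "\<beta> < l - \<epsilon>"
  shows "\<exists>c0>0. \<forall>c. 0 < c \<and> c \<le> c0 \<longrightarrow>
           (\<forall>B :: int \<Rightarrow> 'a \<Rightarrow>\<^sub>L 'a.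
              (\<forall>n. norm (B n) \<le> c * \<gamma> n * \<mu> n powr \<beta> / (\<nu> (n + 1) * \<mu> (n + 1) powr \<beta>)) \<longrightarrow>
              admits_dichotomy \<mu> \<nu> (\<lambda>n. A n + B n))"
proof -
  from assms(1) have \<mu>: "\<And>n. 0 < \<mu> n" "strict_mono \<mu>"
    and \<mu>_top: "filterlim \<mu> at_top at_top" and \<mu>_bot: "(\<mu> \<longlongrightarrow> 0) at_bot"
    by (auto simp: growth_rate_def)
  define \<tau> where "\<tau> n = ln (\<mu> n)" for n
  have "mono \<tau>"
    using \<mu> by (auto simp: mono_def \<tau>_def strict_mono_less_eq)
  have \<nu>_nonneg: "0 \<le> \<nu> n" for n
    using assms(2)[of n] by simp
  obtain G D where "0 < D" and G: "green_function A G"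
    "\<And>m n. G m (n + 1) o\<^sub>L A n = G m n - (if m = n then id_blinfun else 0)"
    "\<And>m n. norm (G m n) \<le> D * \<nu> n * exp (- l * \<bar>\<tau> m - \<tau> n\<bar>)"
    by (rule dichotomy_green_function[OF assms(6) \<mu>, folded \<tau>_def]) (rule that, assumption+)
  have top: "((\<lambda>n. \<nu> n * exp (- l * \<bar>\<tau> m - \<tau> n\<bar>)) \<longlongrightarrow> 0) at_top" for m
  proof -
    obtain M where M: "\<And>n::nat. \<mu> (int n) powr (- \<epsilon>) * \<nu> (int n) \<le> M"
      using assms(10) by (auto simp: bdd_above_def)
    have "\<nu> n \<le> M * exp (\<epsilon> * \<tau> n)" if "0 \<le> n" for n
      using M[of "nat n"] that \<mu>(1)[of n]
      by (simp add: \<tau>_def powr_def exp_minus field_simps)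
    moreover have "filterlim \<tau> at_top at_top"
      unfolding \<tau>_def by (rule filterlim_compose[OF ln_at_top \<mu>_top])
    ultimately show ?thesis
      using assms(5,8) \<nu>_nonneg
      by (intro exp_weight_decay[where M = M and e = \<epsilon>]) (auto simp: eventually_at_top_linorder)
  qed
  have bot: "((\<lambda>n. \<nu> n * exp (- l * \<bar>\<tau> m - \<tau> n\<bar>)) \<longlongrightarrow> 0) at_bot" for m
  proof -
    obtain M where M: "\<And>n::nat. \<mu> (- int n) powr \<epsilon> * \<nu> (- int n) \<le> M"
      using assms(9) by (auto simp: bdd_above_def)
    have "\<nu> n \<le> M * exp (\<epsilon> * - \<tau> n)" if "n \<le> 0" for n
      using M[of "nat (- n)"] that \<mu>(1)[of n]
      by (simp add: \<tau>_def powr_def exp_minus field_simps)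
    \<comment> \<open>At minus infinity \<open>\<tau>\<close> tends to minus infinity, so the decay
      lemma is applied to \<open>- \<tau>\<close>.\<close>
    moreover have "filterlim (\<lambda>n. - \<tau> n) at_top at_bot"
    proof -
      have "filterlim \<mu> (at_right 0) at_bot"
        using \<mu>_bot \<mu>(1) by (auto simp: filterlim_at less_imp_neq [THEN not_sym])
      then have "filterlim \<tau> at_bot at_bot"
        unfolding \<tau>_def by (rule filterlim_compose[OF ln_at_0])
      then show ?thesis by (simp add: filterlim_uminus_at_bot)
    qed
    ultimately have "((\<lambda>n. \<nu> n * exp (- l * \<bar>- \<tau> m - - \<tau> n\<bar>)) \<longlongrightarrow> 0) at_bot"
      using assms(5,8) \<nu>_nonneg
      by (intro exp_weight_decay[where M = M and e = \<epsilon>]) (auto simp: eventually_at_bot_linorder)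
    moreover have "\<bar>- \<tau> m - - \<tau> n\<bar> = \<bar>\<tau> m - \<tau> n\<bar>" for n by simp
    ultimately show ?thesis by (simp only:)
  qed
  define S where "S = infsum \<gamma> UNIV"
  have "0 \<le> S"
    unfolding S_def using assms(3) by (intro infsum_nonneg) (simp add: less_imp_le)
  \<comment> \<open>The choice of \<open>c0\<close> gives \<open>2 * D * S * c \<le> 1 - c\<close>,
    hence the contraction factor 1/2; adding 1 keeps the denominator positive even if
    \<open>S\<close> were zero.\<close>
  show ?thesis
  proof (intro exI[of _ "1 / (2 * D * S + 1)"] conjI allI impI)
    show "0 < 1 / (2 * D * S + 1)"
      using \<open>0 < D\<close> \<open>0 \<le> S\<close> by (simp add: add_nonneg_pos)
    fix c and B :: "int \<Rightarrow> 'a \<Rightarrow>\<^sub>L 'a"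
    assume c: "0 < c \<and> c \<le> 1 / (2 * D * S + 1)"
      and B: "\<forall>n. norm (B n) \<le> c * \<gamma> n * \<mu> n powr \<beta> / (\<nu> (n + 1) * \<mu> (n + 1) powr \<beta>)"
    interpret green_perturbation A B G \<tau> \<nu> \<gamma> D l \<beta> c
    proof
      show "mono \<tau>" by fact
      show "\<nu> (k + 1) * norm (B k) \<le> c * \<gamma> k * exp (- \<beta> * (\<tau> (k + 1) - \<tau> k))" for k
      proof -
        have "exp (- \<beta> * (\<tau> (k + 1) - \<tau> k)) = \<mu> k powr \<beta> / \<mu> (k + 1) powr \<beta>"
          using \<mu>(1)[of k] \<mu>(1)[of "k + 1"] by (simp add: \<tau>_def powr_def exp_diff [symmetric] algebra_simps)
        moreover have "norm (B k) \<le> c * \<gamma> k * (\<mu> k powr \<beta> / \<mu> (k + 1) powr \<beta>) / \<nu> (k + 1)"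
          using B[rule_format, of k] by (simp add: mult_ac)
        moreover have "0 < \<nu> (k + 1)" using assms(2)[of "k + 1"] by linarith
        ultimately show ?thesis by (simp only: pos_le_divide_eq mult.commute)
      qed
      have "c * (2 * D * S + 1) \<le> 1"
        using c \<open>0 < D\<close> \<open>0 \<le> S\<close> by (simp add: pos_le_divide_eq add_nonneg_pos)
      then show "D * c * infsum \<gamma> UNIV \<le> 1 / 2"
        using c by (simp add: S_def algebra_simps)
    \<comment> \<open>The condition \<open>\<beta> \<le> l\<close> follows from
      \<open>\<beta> < l - \<epsilon>\<close> and \<open>0 \<le> \<epsilon>\<close>.\<close>
    qed (use G top bot assms(3,4,7,11,12) \<open>0 < D\<close> c in \<open>auto simp: less_imp_le\<close>)
    obtain H where "green_function (\<lambda>n. A n + B n) H"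
      "\<And>m n. norm (H m n) \<le> 2 * D * \<nu> n * exp (- \<beta> * \<bar>\<tau> m - \<tau> n\<bar>)"
      using perturbed_green_function[OF \<nu>_nonneg] by blast
    then have "dichotomy_exponent \<mu> \<nu> (\<lambda>n. A n + B n) \<beta>"
      unfolding \<tau>_def
    proof (rule green_function_dichotomy[OF _ _ _ \<mu> assms(2)])
      fix y :: "int \<Rightarrow> 'a \<Rightarrow>\<^sub>L 'a" and C
      assume "\<And>m. y (m + 1) = A m + B m o\<^sub>L y m" "\<And>m. norm (y m) \<le> C"
      then show "\<forall>m. y m = 0" using perturbed_unique by blast
    qed (use \<open>0 < D\<close> assms(11) in auto)
    then show "admits_dichotomy \<mu> \<nu> (\<lambda>n. A n + B n)"
      by (auto simp: admits_dichotomy_def)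
  qed
qed

end
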